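(* Let $\alpha\ge 0$ and $n\ge 1$ be integers. Then $$ \overline{SOME}(n)\equiv 0\pmod{2^{\alpha+2}} $$ if and only if $$ \sum_{\substack{k\ge 1,\ m\ge 0\\ k^2+2m=n}}(-1)^m k^2\, r_{2^{\alpha+1}-2}(m)\equiv 0\pmod{2^{\alpha+1}}, $$ where the sum is over all pairs of integers $(k,m)$ with $k\ge1$, $m\ge0$ and $k^2+2m=n$.
   Context: An overpartition of a positive integer $n$ is a partition of $n$ in which the first occurrence of each part size may be overlined. $\overline{SOME}(n)$ is the sum of all odd parts minus the sum of all even parts, taken over all overpartitions of $n$ (parts counted with multiplicity, overlined or not). For integers $t\ge 0$ and $m\ge 0$, $r_t(m)$ denotes the number of representations of $m$ as a sum of $t$ squares of integers, i.e. the number of $(x_1,\dots,x_t)\in\mathbb Z^t$ with $x_1^2+\cdots+x_t^2=m$, with the convention $r_0(0)=1$ and $r_0(m)=0$ for $m>0$. *)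

theory Defs
  imports "HOL-Number_Theory.Number_Theory" "HOL-Library.Multiset"
begin

text \<open>
  An overpartition is encoded as a pair \<open>(M, S)\<close>: \<open>M\<close> is the multiset of all parts (overlined
  or not), and \<open>S\<close> is the set of those part sizes whose first occurrence is overlined.
\<close>
definition overpartitions :: "nat \<Rightarrow> (nat multiset \<times> nat set) set" where
  "overpartitions n = {(M, S). 0 \<notin># M \<and> sum_mset M = n \<and> S \<subseteq> set_mset M}"

definition overline_SOME :: "nat \<Rightarrow> int" where
  "overline_SOME n =
     (\<Sum>(M, S)\<in>overpartitions n. int (\<Sum>\<^sub># (filter_mset odd M)) - int (\<Sum>\<^sub># (filter_mset even M)))"

text \<open>Elements of \<open>\<int>\<^sup>t\<close> are integer lists of length \<open>t\<close>.\<close>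
definition r_squares :: "nat \<Rightarrow> nat \<Rightarrow> nat" where
  "r_squares t m = card {xs :: int list. length xs = t \<and> (\<Sum>x\<leftarrow>xs. x\<^sup>2) = int m}"

lemma r_squares_0: "r_squares 0 m = (if m = 0 then 1 else 0)"
proof -
  have "{xs :: int list. length xs = 0 \<and> (\<Sum>x\<leftarrow>xs. x\<^sup>2) = int m} = (if m = 0 then {[]} else {})"
    by auto
  then show ?thesis
    by (simp add: r_squares_def)
qed

text \<open>
  Since \<open>card\<close> and \<open>sum\<close> return 0 on infinite sets, the following facts are needed for the
  definitions above, and for the sum over pairs \<open>(k, m)\<close>, to have their intended meaning.
\<close>

lemma size_le_sum_mset:
  fixes M :: "nat multiset"
  assumes "0 \<notin># M"
  shows "size M \<le> sum_mset M"
  using assms by (induction M) auto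

lemma finite_overpartitions: "finite (overpartitions n)"
proof (rule finite_subset)
  let ?L = "{xs. set xs \<subseteq> {..n} \<and> length xs \<le> n}"
  show "overpartitions n \<subseteq> (mset ` ?L) \<times> Pow {..n}"
  proof clarify
    fix M S assume *: "(M, S) \<in> overpartitions n"
    have le: "x \<le> n" if "x \<in># M" for x
      using that * by (auto simp: overpartitions_def dest: multi_member_split)
    obtain xs where xs: "M = mset xs"
      by (metis ex_mset)
    have "xs \<in> ?L"
      using le * size_le_sum_mset[of M] by (auto simp: overpartitions_def xs)
    moreover have "S \<in> Pow {..n}"
      using le * by (auto simp: overpartitions_def)
    ultimately show "M \<in> mset ` ?L \<and> S \<in> Pow {..n}"
      using xs by auto
  qed
  show "finite ((mset ` ?L) \<times> Pow {..n})"
    by (intro finite_cartesian_product finite_imageI finite_lists_length_le) auto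
qed

lemma finite_r_squares: "finite {xs :: int list. length xs = t \<and> (\<Sum>x\<leftarrow>xs. x\<^sup>2) = int m}"
proof (rule finite_subset)
  show "finite {xs :: int list. set xs \<subseteq> {- int m..int m} \<and> length xs = t}"
    by (rule finite_lists_length_eq) simp
  have "\<bar>x\<bar> \<le> (\<Sum>x\<leftarrow>xs. x\<^sup>2)" if "x \<in> set xs" for x :: int and xs
  proof -
    have "x\<^sup>2 \<le> (\<Sum>x\<leftarrow>xs. x\<^sup>2)"
      using that by (intro member_le_sum_list) auto
    moreover have "\<bar>x\<bar> \<le> x\<^sup>2"
      using self_le_power[of "\<bar>x\<bar>" 2] by (cases "x = 0") auto
    ultimately show ?thesis by simp
  qed
  then show "{xs :: int list. length xs = t \<and> (\<Sum>x\<leftarrow>xs. x\<^sup>2) = int m}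
      \<subseteq> {xs. set xs \<subseteq> {- int m..int m} \<and> length xs = t}"
    by (fastforce simp: abs_le_iff)
qed

lemma finite_square_plus_double: "finite {(k, m). (1::nat) \<le> k \<and> k\<^sup>2 + 2 * m = n}"
proof (rule finite_subset)
  show "{(k, m). (1::nat) \<le> k \<and> k\<^sup>2 + 2 * m = n} \<subseteq> {..n} \<times> {..n}"
  proof clarify
    fix k m :: nat
    assume "1 \<le> k" "n = k\<^sup>2 + 2 * m"
    moreover have "k \<le> k\<^sup>2" by (simp add: power2_eq_square)
    ultimately show "k \<in> {..k\<^sup>2 + 2 * m} \<and> m \<in> {..k\<^sup>2 + 2 * m}" by simp
  qed
qed simp

end

theory Submission
  imports Defs "HOL-Computational_Algebra.Formal_Power_Series"
begin

unbundle fps_syntax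

text \<open>
  Write \<open>\<phi>(q) = \<Sum>\<^sub>x q\<^bsup>x\<^sup>2\<^esup>\<close> for the theta series, summed over all integers \<open>x\<close>. By Gauss,
  \<open>\<phi>(- q) = \<Prod>\<^sub>j (1 - q\<^sup>j) / (1 + q\<^sup>j)\<close>, the inverse of the overpartition generating function.
  Logarithmic differentiation of this product shows that \<open>overline_SOME\<close> has the generating function
  \<open>q \<phi>'(q) / (\<phi>(q) \<phi>(- q)) = 2 (\<Sum>\<^sub>k k\<^sup>2 q\<^bsup>k\<^sup>2\<^esup>) / \<phi>(- q\<^sup>2)\<^sup>2\<close>, with \<open>k \<ge> 1\<close>. Since \<open>\<phi>(- q\<^sup>2)\<close> is 1 plus
  twice a series, its power with exponent \<open>2 ^ (\<alpha> + 1)\<close> is 1 modulo \<open>2 ^ (\<alpha> + 2)\<close>. Hence the factor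
  \<open>1 / \<phi>(- q\<^sup>2)\<^sup>2\<close> may be replaced by the power of \<open>\<phi>(- q\<^sup>2)\<close> with exponent \<open>2 ^ (\<alpha> + 1) - 2\<close>, whose
  coefficients are signed numbers of representations as sums of squares.
\<close>

section \<open>Gauss's theta identity\<close>

text \<open>
  With \<open>h j = (1 - x\<^sup>j) / (1 + x\<^sup>j)\<close>, this truncates Gauss's identity in the style of Shanks: the
  term \<open>s = 0\<close> is the partial product and all others are divisible by \<open>x ^ Suc n\<close>. The
  hypothesis on \<open>h\<close> is stated without division, so that it makes sense over the integers.
\<close>
lemma gauss_finite_sum:
  fixes x :: "'a :: comm_ring_1" and h :: "nat \<Rightarrow> 'a"
  assumes h0: "h 0 = 0" and h: "\<And>j. j \<ge> 1 \<Longrightarrow> x ^ j * (1 + h j) = 1 - h j"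
  shows "(\<Sum>s\<le>n. (-1) ^ s * x ^ (s * Suc n) * (1 + h s) * prod h {Suc s..n}) =
    1 + 2 * (\<Sum>j=1..n. (-1) ^ j * x ^ j\<^sup>2)"
proof (induction n)
  case 0
  then show ?case by (simp add: h0)
next
  case (Suc n)
  have h': "x ^ j * (1 + h j) = 1 - h j" for j
    using h0 h by (cases "j = 0") auto
  define T where "T n s = (-1) ^ s * x ^ (s * Suc n) * (1 + h s) * prod h {Suc s..n}" for n s
  \<comment> \<open>\<open>U\<close> is an antidifference in \<open>s\<close> of the increment of
    \<open>T\<close> from \<open>n\<close> to \<open>Suc n\<close>. It vanishes at 0 because
    \<open>h 0 = 0\<close>, so only its upper end survives.\<close>
  define U where "U s = (-1) ^ s * x ^ (s * Suc n) * (1 + h (Suc n)) * prod h {s..n}" for s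
  have tele: "T (Suc n) s - T n s = U (Suc s) - U s" if "s \<le> n" for s
  proof -
    define R where "R = prod h {Suc s..n}"
    have 1: "prod h {s..n} = h s * R"
      using that by (simp add: R_def prod.atLeast_Suc_atMost)
    have 2: "prod h {Suc s..Suc n} = R * h (Suc n)"
      using that by (simp add: R_def)
    have "T (Suc n) s - T n s - (U (Suc s) - U s) = (-1) ^ s * x ^ (s * Suc n) * R *
       ((x ^ s * (1 + h s)) * h (Suc n) - (1 + h s) + (x ^ Suc n * (1 + h (Suc n))) + (1 + h (Suc n)) * h s)"
      unfolding T_def U_def 1 2 R_def[symmetric]
      by (simp add: algebra_simps power_add)
    also have "\<dots> = 0"
      unfolding h' by (simp add: algebra_simps)
    finally show ?thesis by simp
  qed
  have U0: "U 0 = 0"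
    by (simp add: U_def h0 prod.atLeast_Suc_atMost)
  have "(\<Sum>s\<le>n. T (Suc n) s) - (\<Sum>s\<le>n. T n s) = (\<Sum>s\<le>n. U (Suc s) - U s)"
    unfolding sum_subtractf[symmetric] by (rule sum.cong) (auto simp: tele)
  also have "\<dots> = U (Suc n)"
    using sum_telescope''[of 0 n] U0 by (simp add: sum_lessThan_telescope flip: lessThan_Suc_atMost)
  finally have "(\<Sum>s\<le>Suc n. T (Suc n) s) = (\<Sum>s\<le>n. T n s) + (U (Suc n) + T (Suc n) (Suc n))"
    by (simp add: algebra_simps)
  also have "U (Suc n) + T (Suc n) (Suc n) =
      (-1) ^ Suc n * x ^ (Suc n * Suc n) * ((1 + h (Suc n)) + x ^ Suc n * (1 + h (Suc n)))"
    by (simp add: U_def T_def algebra_simps power_add)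
  also have "\<dots> = 2 * ((-1) ^ Suc n * x ^ (Suc n)\<^sup>2)"
    unfolding h' by (simp add: power2_eq_square algebra_simps)
  finally show ?case
    unfolding Suc.IH[folded T_def] T_def[symmetric] by (simp add: algebra_simps)
qed

text \<open>The product starts at 1, so \<open>h\<close> may be reset to 0 at 0. In the sum above,
  the terms with \<open>s \<ge> 1\<close> then carry the factor
  \<open>x ^ (s * Suc n)\<close>.\<close>

lemma gauss_finite_product_dvd:
  fixes x :: "'a :: comm_ring_1" and h :: "nat \<Rightarrow> 'a"
  assumes h: "\<And>j. j \<ge> 1 \<Longrightarrow> x ^ j * (1 + h j) = 1 - h j"
  shows "x ^ Suc n dvd 1 + 2 * (\<Sum>j=1..n. (-1) ^ j * x ^ j\<^sup>2) - (\<Prod>j=1..n. h j)"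
proof -
  define g where "g = h(0 := 0)"
  have g: "x ^ j * (1 + g j) = 1 - g j" if "j \<ge> 1" for j
    using that h by (simp add: g_def)
  have "1 + 2 * (\<Sum>j=1..n. (-1) ^ j * x ^ j\<^sup>2) =
      (\<Sum>s\<le>n. (-1) ^ s * x ^ (s * Suc n) * (1 + g s) * prod g {Suc s..n})"
    by (rule gauss_finite_sum[symmetric]) (use g in \<open>auto simp: g_def\<close>)
  also have "\<dots> = prod g {1..n} +
      (\<Sum>s=1..n. (-1) ^ s * x ^ (s * Suc n) * (1 + g s) * prod g {Suc s..n})"
    by (simp add: sum.atLeast_Suc_atMost g_def flip: atLeast0AtMost)
  also have "prod g {1..n} = prod h {1..n}"
    by (rule prod.cong) (auto simp: g_def)
  finally have eq: "1 + 2 * (\<Sum>j=1..n. (-1) ^ j * x ^ j\<^sup>2) - (\<Prod>j=1..n. h j) =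
      (\<Sum>s=1..n. (-1) ^ s * x ^ (s * Suc n) * (1 + g s) * prod g {Suc s..n})"
    by simp
  have "x ^ Suc n dvd x ^ (s * Suc n)" if "s \<ge> 1" for s
    using that by (intro le_imp_power_dvd) (cases s, auto)
  then show ?thesis
    unfolding eq by (intro dvd_sum) (auto intro!: dvd_mult2 intro: dvd_mult)
qed


section \<open>Truncated power series\<close>

lemma fps_nth_eq_if_X_power_dvd:
  fixes f g :: "'a :: comm_ring_1 fps"
  assumes "fps_X ^ k dvd f - g" "i < k"
  shows "f $ i = g $ i"
proof -
  from assms obtain u where "f - g = fps_X ^ k * u" by (auto elim: dvdE)
  then have "(f - g) $ i = 0"
    using assms by (simp add: fps_X_power_mult_nth)
  then show ?thesis by simp
qed

lemma fps_mult_nth_cong_le: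
  fixes f g :: "'a :: comm_semiring_1 fps"
  assumes "\<And>i. i \<le> n \<Longrightarrow> f $ i = f' $ i" "\<And>i. i \<le> n \<Longrightarrow> g $ i = g' $ i" "i \<le> n"
  shows "(f * g) $ i = (f' * g') $ i"
  using assms by (auto simp: fps_mult_nth intro!: sum.cong)

lemma fps_power_nth_cong_le:
  fixes f g :: "'a :: comm_semiring_1 fps"
  assumes "\<And>i. i \<le> n \<Longrightarrow> f $ i = g $ i" "i \<le> n"
  shows "(f ^ k) $ i = (g ^ k) $ i"
  using assms(2)
proof (induction k arbitrary: i)
  case (Suc k)
  then show ?case
    by (auto intro!: fps_mult_nth_cong_le[where n = n] simp: assms(1))
qed simp

text \<open>Each squaring gains a factor 2: both the cross term and the square of
  \<open>2 ^ Suc k * v\<close> are divisible by \<open>2 ^ Suc (Suc k)\<close>.\<close>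

lemma one_plus_two_power_two_power:
  fixes w :: "'a :: comm_ring_1"
  shows "\<exists>v. (1 + 2 * w) ^ (2 ^ k) = 1 + 2 ^ Suc k * v"
proof (induction k)
  case (Suc k)
  then obtain v where v: "(1 + 2 * w) ^ (2 ^ k) = 1 + 2 ^ Suc k * v" by blast
  have "(1 + 2 * w) ^ (2 ^ Suc k) = ((1 + 2 * w) ^ (2 ^ k))\<^sup>2"
    by (simp add: power_mult [symmetric] mult.commute)
  also have "\<dots> = 1 + 2 ^ Suc (Suc k) * (v + 2 ^ k * v\<^sup>2)"
    unfolding v by (simp add: power2_eq_square algebra_simps)
  finally show ?case by blast
qed auto


section \<open>The factors of the overpartition product\<close>

text \<open>The series of \<open>(1 + c X\<^sup>j) / (1 - c X\<^sup>j)\<close>, for \<open>j \<ge> 1\<close>.\<close>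
definition cayley_fps :: "int \<Rightarrow> nat \<Rightarrow> int fps" where
  "cayley_fps c j = Abs_fps (\<lambda>i. if i = 0 then 1 else if j dvd i then 2 * c ^ (i div j) else 0)"

text \<open>The coefficients at positive multiples of \<open>j\<close> are geometric with ratio
  \<open>c\<close>, so the product cancels beyond \<open>j\<close>. At \<open>j\<close> itself the
  constant term 1, in place of 2, leaves \<open>2 * c - c = c\<close>.\<close>

lemma cayley_fps_eq:
  assumes "j \<ge> 1"
  shows "cayley_fps c j * (1 - fps_const c * fps_X ^ j) = 1 + fps_const c * fps_X ^ j"
proof (rule fps_ext)
  fix i
  have "(cayley_fps c j * (1 - fps_const c * fps_X ^ j)) $ i =
     cayley_fps c j $ i - c * (fps_X ^ j * cayley_fps c j) $ i"
    by (simp add: algebra_simps fps_mult_left_const_nth)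
  also have "\<dots> = (1 + fps_const c * fps_X ^ j) $ i"
  proof (cases "i < j")
    case True
    then show ?thesis using assms
      by (auto simp: fps_X_power_mult_nth cayley_fps_def dest: nat_dvd_not_less)
  next
    case False
    show ?thesis
    proof (cases "i = j")
      case True
      then show ?thesis using assms
        by (auto simp: fps_X_power_mult_nth cayley_fps_def)
    next
      case ne: False
      have "j dvd (i - j) \<longleftrightarrow> j dvd i" using False
        by (simp add: dvd_minus_self)
      moreover have "i div j = Suc ((i - j) div j)"
        using False assms by (subst le_div_geq) auto
      ultimately show ?thesis using assms False ne
        by (auto simp: fps_X_power_mult_nth cayley_fps_def)
    qed
  qed
  finally show "(cayley_fps c j * (1 - fps_const c * fps_X ^ j)) $ i = (1 + fps_const c * fps_X ^ j) $ i" .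
qed

lemma cayley_fps_minus:
  "j \<ge> 1 \<Longrightarrow> fps_X ^ j * (1 + cayley_fps (-1) j) = 1 - cayley_fps (-1) j"
  using cayley_fps_eq[of j "-1"] by (simp add: algebra_simps flip: fps_const_neg)

lemma cayley_fps_plus:
  "j \<ge> 1 \<Longrightarrow> - (fps_X ^ j) * (1 + cayley_fps 1 j) = 1 - cayley_fps 1 j"
  using cayley_fps_eq[of j 1] by (simp add: algebra_simps)

lemma cayley_fps_mult_minus:
  assumes "j \<ge> 1"
  shows "cayley_fps 1 j * cayley_fps (-1) j = 1"
proof -
  define H J y where "H = cayley_fps 1 j" and "J = cayley_fps (-1) j" and "y = (fps_X ^ j :: int fps)"
  have H: "H * (1 - y) = 1 + y" and J: "J * (1 + y) = 1 - y"
    using cayley_fps_eq[OF assms, of 1] cayley_fps_eq[OF assms, of "-1"]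
    by (simp_all add: H_def J_def y_def flip: fps_const_neg)
  have "(1 - y) $ 0 \<noteq> 0" using assms by (simp add: y_def)
  then have "1 - y \<noteq> 0" by (metis fps_zero_nth)
  moreover have "H * J * (1 - y) = 1 * (1 - y)"
    using H J by (metis mult.assoc mult.commute mult_1)
  ultimately show ?thesis
    unfolding H_def J_def by (metis mult_right_cancel)
qed


section \<open>Generating functions of overpartitions\<close>

text \<open>A bound on the parts replaces the infinite product by finite ones, built by recursion on
  \<open>N\<close>. Any \<open>N \<ge> n\<close> admits all partitions of \<open>n\<close>.\<close>

definition bounded_partitions :: "nat \<Rightarrow> nat \<Rightarrow> nat multiset set" where
  "bounded_partitions N n = {M. set_mset M \<subseteq> {1..N} \<and> sum_mset M = n}"

lemma finite_bounded_partitions: "finite (bounded_partitions N n)"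
proof -
  have "bounded_partitions N n \<subseteq> fst ` overpartitions n"
    by (force simp: bounded_partitions_def overpartitions_def image_iff)
  then show ?thesis
    using finite_overpartitions finite_subset by blast
qed

definition alternating_weight :: "nat multiset \<Rightarrow> int" where
  "alternating_weight M = int (\<Sum>\<^sub># (filter_mset odd M)) - int (\<Sum>\<^sub># (filter_mset even M))"

text \<open>The weight depends on \<open>M\<close> alone, so the sum over \<open>S\<close> only
  counts the subsets of the set of part sizes.\<close>

lemma overline_SOME_eq:
  assumes "n \<le> N"
  shows "overline_SOME n =
    (\<Sum>M\<in>bounded_partitions N n. 2 ^ card (set_mset M) * alternating_weight M)"
proof -
  have "overpartitions n = Sigma (bounded_partitions N n) (\<lambda>M. Pow (set_mset M))"
  proof -
    have "x \<le> sum_mset M" if "x \<in># M" for x and M :: "nat multiset"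
      using that by (auto dest: multi_member_split)
    then show ?thesis using assms
      by (fastforce simp: overpartitions_def bounded_partitions_def Suc_le_eq intro!: gr0I)
  qed
  then have "overline_SOME n =
      (\<Sum>M\<in>bounded_partitions N n. \<Sum>S\<in>Pow (set_mset M). alternating_weight M)"
    unfolding overline_SOME_def alternating_weight_def[symmetric]
    by (subst sum.Sigma) (auto simp: finite_bounded_partitions)
  also have "\<dots> = (\<Sum>M\<in>bounded_partitions N n. 2 ^ card (set_mset M) * alternating_weight M)"
    by (simp add: card_Pow)
  finally show ?thesis .
qed

lemma filter_replicate_mset:
  "filter_mset P (replicate_mset a x) = (if P x then replicate_mset a x else {#})"
  by (induction a) auto

text \<open>Split off all copies of the largest allowed part; \<open>i\<close> is the total they
  contribute. A general \<open>f\<close> serves both the plain and the weighted count.\<close>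

lemma sum_bounded_partitions_Suc:
  fixes f :: "nat multiset \<Rightarrow> int"
  shows "(\<Sum>M\<in>bounded_partitions (Suc N) n. 2 ^ card (set_mset M) * f M) =
    (\<Sum>i=0..n. cayley_fps 1 (Suc N) $ i * (\<Sum>M\<in>bounded_partitions N (n - i).
       2 ^ card (set_mset M) * f (M + replicate_mset (i div Suc N) (Suc N))))"
proof -
  define k where "k = Suc N"
  define I where "I = {i. i \<le> n \<and> k dvd i}"
  have fin: "finite I" by (simp add: I_def)
  have k: "k > 0" by (simp add: k_def)
  have "(\<Sum>M\<in>bounded_partitions k n. 2 ^ card (set_mset M) * f M) =
    (\<Sum>(i, M)\<in>Sigma I (\<lambda>i. bounded_partitions N (n - i)).
      2 ^ card (set_mset (M + replicate_mset (i div k) k)) * f (M + replicate_mset (i div k) k))"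
  proof (rule sum.reindex_bij_witness[where
        i = "\<lambda>(i, M). M + replicate_mset (i div k) k" and
        j = "\<lambda>M. (k * count M k, filter_mset (\<lambda>x. x \<noteq> k) M)"])
    fix M assume M: "M \<in> bounded_partitions k n"
    have split: "filter_mset (\<lambda>x. x \<noteq> k) M + replicate_mset (count M k) k = M"
      by (rule multiset_eqI) auto
    then show eq: "(case (k * count M k, filter_mset (\<lambda>x. x \<noteq> k) M) of
        (i, M) \<Rightarrow> M + replicate_mset (i div k) k) = M"
      using k by simp
    have "sum_mset M = sum_mset (filter_mset (\<lambda>x. x \<noteq> k) M) + k * count M k"
      by (subst split[symmetric], subst sum_mset.union) (simp add: sum_mset_replicate_mset mult.commute)
    moreover have "set_mset (filter_mset (\<lambda>x. x \<noteq> k) M) \<subseteq> {1..N}" "sum_mset M = n"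
      using M by (auto simp: bounded_partitions_def k_def)
    ultimately show "(k * count M k, filter_mset (\<lambda>x. x \<noteq> k) M) \<in> Sigma I (\<lambda>i. bounded_partitions N (n - i))"
      unfolding I_def bounded_partitions_def by simp
    show "(case (k * count M k, filter_mset (\<lambda>x. x \<noteq> k) M) of
        (i, M) \<Rightarrow> 2 ^ card (set_mset (M + replicate_mset (i div k) k)) * f (M + replicate_mset (i div k) k)) =
        2 ^ card (set_mset M) * f M"
      using eq by (metis (no_types, lifting) case_prod_conv)
  next
    fix p assume p: "p \<in> Sigma I (\<lambda>i. bounded_partitions N (n - i))"
    obtain i M where [simp]: "p = (i, M)" by (cases p)
    have M: "set_mset M \<subseteq> {1..N}" "sum_mset M = n - i" "i \<le> n" "k dvd i"
      using p by (auto simp: I_def bounded_partitions_def)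
    then have "k \<notin># M" by (auto simp: k_def)
    then have "count M k = 0" by (simp add: not_in_iff)
    moreover from this have "filter_mset (\<lambda>x. x \<noteq> k) M = M"
      by (intro multiset_eqI) auto
    ultimately show "(k * count (case p of (i, M) \<Rightarrow> M + replicate_mset (i div k) k) k,
        filter_mset (\<lambda>x. x \<noteq> k) (case p of (i, M) \<Rightarrow> M + replicate_mset (i div k) k)) = p"
      using M by (simp add: filter_replicate_mset)
    show "(case p of (i, M) \<Rightarrow> M + replicate_mset (i div k) k) \<in> bounded_partitions k n"
      using M by (auto simp: bounded_partitions_def sum_mset_replicate_mset k split: if_splits)
        (auto simp: k_def)
  qed
  also have "\<dots> = (\<Sum>i\<in>I. \<Sum>M\<in>bounded_partitions N (n - i).
      2 ^ card (set_mset (M + replicate_mset (i div k) k)) * f (M + replicate_mset (i div k) k))"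
    by (subst sum.Sigma) (auto simp: fin finite_bounded_partitions)
  also have "\<dots> = (\<Sum>i\<in>I. cayley_fps 1 k $ i * (\<Sum>M\<in>bounded_partitions N (n - i).
       2 ^ card (set_mset M) * f (M + replicate_mset (i div k) k)))"
  proof (intro sum.cong refl)
    fix i assume i: "i \<in> I"
    show "(\<Sum>M\<in>bounded_partitions N (n - i).
      2 ^ card (set_mset (M + replicate_mset (i div k) k)) * f (M + replicate_mset (i div k) k)) =
      cayley_fps 1 k $ i * (\<Sum>M\<in>bounded_partitions N (n - i).
       2 ^ card (set_mset M) * f (M + replicate_mset (i div k) k))"
      unfolding sum_distrib_left
    proof (intro sum.cong refl)
      fix M assume "M \<in> bounded_partitions N (n - i)"
      then have "k \<notin># M" by (auto simp: k_def bounded_partitions_def)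
      \<comment> \<open>A positive \<open>i\<close> adds the new part size \<open>k\<close>,
        overlined or not: hence the coefficient 2, against 1 at \<open>i = 0\<close>.\<close>
      moreover have "i div k = 0 \<longleftrightarrow> i = 0"
        using i k by (auto simp: I_def dvd_def)
      ultimately show "2 ^ card (set_mset (M + replicate_mset (i div k) k)) * f (M + replicate_mset (i div k) k) =
         cayley_fps 1 k $ i * (2 ^ card (set_mset M) * f (M + replicate_mset (i div k) k))"
        using i by (auto simp: cayley_fps_def I_def)
    qed
  qed
  also have "\<dots> = (\<Sum>i=0..n. cayley_fps 1 k $ i * (\<Sum>M\<in>bounded_partitions N (n - i).
       2 ^ card (set_mset M) * f (M + replicate_mset (i div k) k)))"
    by (rule sum.mono_neutral_left) (auto simp: I_def cayley_fps_def)
  finally show ?thesis unfolding k_def .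
qed

definition count_fps :: "nat \<Rightarrow> int fps" where
  "count_fps N = Abs_fps (\<lambda>n. \<Sum>M\<in>bounded_partitions N n. 2 ^ card (set_mset M))"

definition weight_fps :: "nat \<Rightarrow> int fps" where
  "weight_fps N =
     Abs_fps (\<lambda>n. \<Sum>M\<in>bounded_partitions N n. 2 ^ card (set_mset M) * alternating_weight M)"

lemma bounded_partitions_0: "bounded_partitions 0 n = (if n = 0 then {{#}} else {})"
  by (auto simp: bounded_partitions_def)

lemma count_fps_0: "count_fps 0 = 1"
  by (rule fps_ext) (simp add: count_fps_def bounded_partitions_0)

lemma weight_fps_0: "weight_fps 0 = 0"
  by (rule fps_ext) (simp add: weight_fps_def bounded_partitions_0 alternating_weight_def)

lemma count_fps_Suc: "count_fps (Suc N) = cayley_fps 1 (Suc N) * count_fps N"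
proof (rule fps_ext)
  fix n show "count_fps (Suc N) $ n = (cayley_fps 1 (Suc N) * count_fps N) $ n"
    using sum_bounded_partitions_Suc[where N = N and n = n and f = "\<lambda>_. 1"] by (simp add: count_fps_def fps_mult_nth)
qed

lemma alternating_weight_add_replicate:
  "alternating_weight (M + replicate_mset a j) = alternating_weight M - (-1) ^ j * int (a * j)"
proof -
  show ?thesis
    by (auto simp: alternating_weight_def filter_replicate_mset sum_mset_replicate_mset)
qed

text \<open>Copies of total size \<open>i\<close> shift the weight by \<open>i\<close>, up to the
  parity sign, and multiplying the coefficient at \<open>i\<close> by \<open>i\<close> is the
  operator X d/dX.\<close>

lemma weight_fps_Suc:
  "weight_fps (Suc N) = cayley_fps 1 (Suc N) * weight_fps N -
     (-1) ^ Suc N * (fps_X * fps_deriv (cayley_fps 1 (Suc N))) * count_fps N"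
proof (rule fps_ext)
  fix n
  define H where "H = cayley_fps 1 (Suc N)"
  define T where "T = fps_X * fps_deriv H"
  have c: "(-1) ^ Suc N = fps_const ((-1) ^ Suc N :: int)"
    by (simp flip: fps_const_power fps_const_neg)
  have "weight_fps (Suc N) $ n = (\<Sum>i=0..n. H $ i * (\<Sum>M\<in>bounded_partitions N (n - i).
       2 ^ card (set_mset M) * (alternating_weight M - (-1) ^ Suc N * int (i div Suc N * Suc N))))"
    unfolding H_def weight_fps_def fps_nth_Abs_fps sum_bounded_partitions_Suc alternating_weight_add_replicate ..
  also have "\<dots> = (\<Sum>i=0..n. H $ i * weight_fps N $ (n - i) -
       (-1) ^ Suc N * (fps_X * fps_deriv H) $ i * count_fps N $ (n - i))"
  proof (intro sum.cong refl)
    fix i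
    \<comment> \<open>The coefficient of \<open>H\<close> vanishes unless \<open>Suc N\<close>
      divides \<open>i\<close>, and then the rounding in \<open>i div Suc N * Suc N\<close> is
      exact.\<close>
    have "H $ i * int (i div Suc N * Suc N) = (fps_X * fps_deriv H) $ i"
    proof -
      have "H $ i * int (i div Suc N * Suc N) = int i * H $ i"
        unfolding H_def cayley_fps_def fps_nth_Abs_fps by (simp del: of_nat_Suc of_nat_mult mult_Suc_right)
      then show ?thesis by (cases i) auto
    qed
    then have 1: "(fps_X * fps_deriv H) $ i = H $ i * int (i div Suc N * Suc N)" ..
    have 2: "(\<Sum>M\<in>bounded_partitions N (n - i).
       2 ^ card (set_mset M) * (alternating_weight M - (-1) ^ Suc N * int (i div Suc N * Suc N))) =
       weight_fps N $ (n - i) - (-1) ^ Suc N * int (i div Suc N * Suc N) * count_fps N $ (n - i)"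
      by (simp add: weight_fps_def count_fps_def right_diff_distrib sum_subtractf sum_distrib_left
        sum_distrib_right mult_ac del: power_Suc of_nat_mult of_nat_Suc)
    show "H $ i * (\<Sum>M\<in>bounded_partitions N (n - i).
       2 ^ card (set_mset M) * (alternating_weight M - (-1) ^ Suc N * int (i div Suc N * Suc N))) =
       H $ i * weight_fps N $ (n - i) -
       (-1) ^ Suc N * (fps_X * fps_deriv H) $ i * count_fps N $ (n - i)"
      unfolding 1 2 by (simp only: algebra_simps)
  qed
  also have "\<dots> = (H * weight_fps N - (-1) ^ Suc N * (fps_X * fps_deriv H) * count_fps N) $ n"
    unfolding T_def[symmetric] unfolding c fps_sub_nth mult.assoc fps_mult_left_const_nth
    by (simp only: fps_mult_nth sum_subtractf sum_distrib_left mult.assoc)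
  finally show "weight_fps (Suc N) $ n = (cayley_fps 1 (Suc N) * weight_fps N -
     (-1) ^ Suc N * (fps_X * fps_deriv (cayley_fps 1 (Suc N))) * count_fps N) $ n"
    unfolding H_def .
qed

text \<open>The series of \<open>(1 - x\<^sup>j) / (1 + x\<^sup>j)\<close> at \<open>x = - X\<close>.\<close>
definition twisted_factor :: "nat \<Rightarrow> int fps" where
  "twisted_factor j = cayley_fps (if even j then - 1 else 1) j"

lemma twisted_factor_eq:
  assumes "j \<ge> 1"
  shows "(- fps_X) ^ j * (1 + twisted_factor j) = 1 - twisted_factor j"
proof (cases "even j")
  case True
  then show ?thesis
    using cayley_fps_minus[OF assms] by (simp only: twisted_factor_def power_minus_even if_True)
next
  case False
  then show ?thesis
    using cayley_fps_plus[OF assms] by (simp add: twisted_factor_def power_minus_odd)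
qed

lemma count_fps_mult: "count_fps N * (\<Prod>j=1..N. cayley_fps (-1) j) = 1"
proof (induction N)
  case (Suc N)
  have "count_fps (Suc N) * (\<Prod>j=1..Suc N. cayley_fps (-1) j) =
     (cayley_fps 1 (Suc N) * cayley_fps (-1) (Suc N)) * (count_fps N * (\<Prod>j=1..N. cayley_fps (-1) j))"
    by (simp add: count_fps_Suc mult_ac)
  also have "\<dots> = 1"
    unfolding Suc.IH by (simp add: cayley_fps_mult_minus)
  finally show ?case .
qed (simp add: count_fps_0)

text \<open>Logarithmic differentiation: passing from \<open>X\<close> to \<open>- X\<close> inverts the factors with odd \<open>j\<close>,
  which accounts for the sign that the weight gives to parts of size \<open>j\<close>.\<close>
lemma weight_fps_mult:
  "weight_fps N * (\<Prod>j=1..N. cayley_fps (-1) j) * (\<Prod>j=1..N. twisted_factor j) =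
     fps_X * fps_deriv (\<Prod>j=1..N. twisted_factor j)"
proof (induction N)
  case (Suc N)
  define H where "H = cayley_fps 1 (Suc N)"
  define J where "J = cayley_fps (-1) (Suc N)"
  define U where "U = twisted_factor (Suc N)"
  define e where "e = ((-1) ^ Suc N :: int fps)"
  define P where "P = (\<Prod>j=1..N. cayley_fps (-1) j)"
  define Q where "Q = (\<Prod>j=1..N. twisted_factor j)"
  have HJ: "H * J = 1"
    using cayley_fps_mult_minus[of "Suc N"] by (simp add: H_def J_def)
  have CP: "count_fps N * P = 1"
    using count_fps_mult by (simp add: P_def)
  have "fps_deriv (H * J) = 0" by (simp add: HJ)
  \<comment> \<open>Multiplying by \<open>J\<close>, the inverse of \<open>H\<close>, isolates
    \<open>fps_deriv J\<close>.\<close>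
  then have "J * (H * fps_deriv J + fps_deriv H * J) = 0" by simp
  then have dJ: "fps_deriv J = - fps_deriv H * J * J"
    using HJ by (simp add: algebra_simps) (metis add.commute add_eq_0_iff mult.assoc mult.commute mult_1)
  have dU: "- e * fps_deriv H * J * U = fps_deriv U"
  proof (cases "even (Suc N)")
    case True
    then have "U = J" "e = 1"
      unfolding U_def J_def e_def twisted_factor_def by auto
    then show ?thesis using dJ by simp
  next
    case False
    then have "U = H" "e = -1"
      unfolding U_def H_def e_def twisted_factor_def by auto
    then show ?thesis using HJ by (simp add: mult_ac)
  qed
  \<comment> \<open>The two terms of the recursion for \<open>weight_fps\<close> become the two
    terms of the product rule for \<open>Q * U\<close>.\<close>
  have "weight_fps (Suc N) * (P * J) * (Q * U) =
      (weight_fps N * P * Q) * (H * J) * U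
      + fps_X * Q * (count_fps N * P) * (- e * fps_deriv H * J * U)"
    unfolding weight_fps_Suc H_def[symmetric] e_def[symmetric] by (simp add: algebra_simps)
  also have "\<dots> = fps_X * fps_deriv (Q * U)"
    unfolding HJ CP dU Suc.IH[folded P_def Q_def] by (simp add: algebra_simps)
  finally show ?case
    by (simp add: P_def J_def Q_def U_def)
qed (simp add: weight_fps_0)

text \<open>Finite form of \<phi>(-q) \<phi>(q) = \<phi>(-q^2)^2: the two factors with the same odd
  index are inverse to each other, those with the same even index are equal.\<close>

lemma prod_twisted_factor_mult:
  "(\<Prod>j=1..2*n. cayley_fps (-1) j) * (\<Prod>j=1..2*n. twisted_factor j) =
    (\<Prod>j=1..n. cayley_fps (-1) (2 * j))\<^sup>2"
proof (induction n)
  case (Suc n)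
  define A where "A = (\<Prod>j=1..2*n. cayley_fps (-1) j)"
  define B where "B = (\<Prod>j=1..2*n. twisted_factor j)"
  have "(\<Prod>j=1..2*Suc n. cayley_fps (-1) j) * (\<Prod>j=1..2*Suc n. twisted_factor j) =
    (A * B) * (cayley_fps 1 (Suc (2 * n)) * cayley_fps (-1) (Suc (2 * n))) * (cayley_fps (-1) (2 * Suc n))\<^sup>2"
    by (simp add: A_def B_def twisted_factor_def power2_eq_square mult_ac)
  also have "\<dots> = (\<Prod>j=1..Suc n. cayley_fps (-1) (2 * j))\<^sup>2"
    using Suc cayley_fps_mult_minus[of "Suc (2 * n)"]
    by (simp add: A_def B_def power_mult_distrib)
  finally show ?case .
qed simp


section \<open>Sums of squares\<close>

lemma sum_symmetric_int:
  fixes f :: "int \<Rightarrow> 'a :: comm_monoid_add"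
  shows "(\<Sum>x=-int n..int n. f x) = f 0 + (\<Sum>j=1..n. f (int j) + f (- int j))"
proof (induction n)
  case (Suc n)
  have "{-int (Suc n)..int (Suc n)} = insert (int (Suc n)) (insert (- int (Suc n)) {-int n..int n})"
    by auto
  then show ?case using Suc by (simp add: add_ac)
qed simp

text \<open>Split off the first coordinate \<open>x\<close>. Since any \<open>n \<ge> m\<close>
  bounds it, one range of summation serves all \<open>m\<close> up to \<open>n\<close>.\<close>

lemma r_squares_Suc:
  assumes "m \<le> n"
  shows "r_squares (Suc t) m = (\<Sum>x=-int n..int n. if x\<^sup>2 \<le> int m then r_squares t (m - nat (x\<^sup>2)) else 0)"
proof -
  define A where "A m = {xs :: int list. length xs = t \<and> (\<Sum>x\<leftarrow>xs. x\<^sup>2) = int m}" for m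
  define B where "B = {x \<in> {-int n..int n}. x\<^sup>2 \<le> int m}"
  have finB: "finite B"
    unfolding B_def by (rule finite_Collect_conjI) simp
  have nn: "(\<Sum>x\<leftarrow>xs. x\<^sup>2) \<ge> 0" for xs :: "int list"
    by (rule sum_list_nonneg) auto
  have le: "\<bar>x\<bar> \<le> int n" if "x\<^sup>2 \<le> int m" for x :: int
  proof -
    have "\<bar>x\<bar> \<le> x\<^sup>2"
      using self_le_power[of "\<bar>x\<bar>" 2] by (cases "x = 0") auto
    then show ?thesis using that assms by linarith
  qed
  have "{xs :: int list. length xs = Suc t \<and> (\<Sum>x\<leftarrow>xs. x\<^sup>2) = int m} =
      (\<lambda>(x, xs). x # xs) ` Sigma B (\<lambda>x. A (m - nat (x\<^sup>2)))" (is "?L = ?R")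
  proof (intro equalityI subsetI)
    fix ys assume "ys \<in> ?L"
    then obtain x xs where ys: "ys = x # xs" "length xs = t" "x\<^sup>2 + (\<Sum>x\<leftarrow>xs. x\<^sup>2) = int m"
      by (auto simp: length_Suc_conv)
    then have *: "x\<^sup>2 \<le> int m" using nn[of xs] by linarith
    then have "x \<in> B" using le[OF *] by (auto simp: B_def)
    moreover have "xs \<in> A (m - nat (x\<^sup>2))"
      using ys * by (auto simp: A_def of_nat_diff nat_le_iff)
    ultimately show "ys \<in> ?R" using ys by auto
  next
    fix ys assume "ys \<in> ?R"
    then show "ys \<in> ?L"
      by (auto simp: A_def B_def of_nat_diff nat_le_iff)
  qed
  moreover have "inj_on (\<lambda>(x, xs). x # xs) (Sigma B (\<lambda>x. A (m - nat (x\<^sup>2))))"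
    by (auto simp: inj_on_def)
  ultimately have "r_squares (Suc t) m = card (Sigma B (\<lambda>x. A (m - nat (x\<^sup>2))))"
    by (simp add: r_squares_def card_image)
  also have "\<dots> = (\<Sum>x\<in>B. r_squares t (m - nat (x\<^sup>2)))"
    by (subst card_SigmaI) (simp_all add: finB A_def finite_r_squares r_squares_def)
  also have "\<dots> = (\<Sum>x=-int n..int n. if x\<^sup>2 \<le> int m then r_squares t (m - nat (x\<^sup>2)) else 0)"
    unfolding B_def by (rule sum.inter_filter) simp
  finally show ?thesis .
qed

corollary r_squares_Suc':
  assumes "m \<le> n"
  shows "r_squares (Suc t) m =
    r_squares t m + 2 * (\<Sum>j=1..n. if j\<^sup>2 \<le> m then r_squares t (m - j\<^sup>2) else 0)"
proof -
  have *: "(int j)\<^sup>2 \<le> int m \<longleftrightarrow> j\<^sup>2 \<le> m" "nat ((int j)\<^sup>2) = j\<^sup>2" for j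
    by (simp_all flip: of_nat_power)
  show ?thesis
    unfolding r_squares_Suc[OF assms] sum_symmetric_int
    by (simp add: * sum_distrib_left mult_2 cong: if_cong)
qed

text \<open>A partial sum of \<phi>(-q^2), with the terms at \<open>j\<close> and \<open>- j\<close>
  combined.\<close>

definition theta_trunc :: "nat \<Rightarrow> int fps" where
  "theta_trunc n = 1 + 2 * (\<Sum>j=1..n. (-1) ^ j * (fps_X\<^sup>2) ^ j\<^sup>2)"

text \<open>An integer and its square have the same parity, so the signs of \<open>t\<close> chosen
  terms multiply to (-1)^m, where m is the sum of the squares and 2m the exponent. Up to
  \<open>n\<close> the truncation loses no representation.\<close>

lemma theta_trunc_power_nth:
  assumes "i \<le> n"
  shows "(theta_trunc n ^ t) $ i = (if even i then (-1) ^ (i div 2) * int (r_squares t (i div 2)) else 0)"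
  using assms
proof (induction t arbitrary: i)
  case 0
  then show ?case by (auto simp: r_squares_0)
next
  case (Suc t)
  define F where "F = theta_trunc n ^ t"
  have c: "(-1) ^ j = fps_const ((-1) ^ j :: int)" for j
    by (simp flip: fps_const_power fps_const_neg)
  have "theta_trunc n ^ Suc t = F + 2 * (\<Sum>j=1..n. (-1) ^ j * ((fps_X\<^sup>2) ^ j\<^sup>2 * F))"
    by (simp add: F_def theta_trunc_def algebra_simps sum_distrib_left sum_distrib_right)
  also have "\<dots> $ i = F $ i + 2 * (\<Sum>j=1..n. (-1) ^ j * (if i < 2 * j\<^sup>2 then 0 else F $ (i - 2 * j\<^sup>2)))"
    unfolding c by (simp add: fps_sum_nth fps_X_power_mult_nth numeral_fps_const
        fps_mult_left_const_nth flip: power_mult)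
  also have "\<dots> = (if even i then (-1) ^ (i div 2) * int (r_squares (Suc t) (i div 2)) else 0)"
  proof (cases "even i")
    case False
    then have "(if i < 2 * j\<^sup>2 then 0 else F $ (i - 2 * j\<^sup>2)) = 0" for j
      using Suc by (simp add: F_def)
    then show ?thesis using False Suc by (simp add: F_def)
  next
    case True
    define m where "m = i div 2"
    have i: "i = 2 * m" using True by (simp add: m_def)
    have "(-1) ^ j * (if i < 2 * j\<^sup>2 then 0 else F $ (i - 2 * j\<^sup>2)) =
       (-1) ^ m * int (if j\<^sup>2 \<le> m then r_squares t (m - j\<^sup>2) else 0)" for j
    proof (cases "j\<^sup>2 \<le> m")
      case True
      have "i - 2 * j\<^sup>2 = 2 * (m - j\<^sup>2)" by (simp add: i)
      then have "F $ (i - 2 * j\<^sup>2) = (-1) ^ (m - j\<^sup>2) * int (r_squares t (m - j\<^sup>2))"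
        using Suc.IH[of "i - 2 * j\<^sup>2"] Suc.prems by (simp add: F_def)
      moreover have "(-1) ^ j * (-1) ^ (m - j\<^sup>2) = ((-1) ^ m :: int)"
        using True by (simp add: minus_one_power_iff)
      ultimately show ?thesis using True
        by (simp add: i flip: mult.assoc)
    qed (simp add: i)
    then show ?thesis
      using Suc True r_squares_Suc'[of m n t] by (simp add: F_def i sum_distrib_left distrib_left mult_ac)
  qed
  finally show ?case .
qed


section \<open>The congruence\<close>

text \<open>Gauss's identity at x = X^2, where the error starts only at exponent
  \<open>2 * Suc n\<close>.\<close>

lemma theta_trunc_nth_eq:
  assumes "i \<le> n"
  shows "theta_trunc n $ i = (\<Prod>j=1..n. cayley_fps (-1) (2 * j)) $ i"
proof -
  have "(fps_X\<^sup>2) ^ Suc n dvd 1 + 2 * (\<Sum>j=1..n. (-1) ^ j * (fps_X\<^sup>2) ^ j\<^sup>2) - (\<Prod>j=1..n. cayley_fps (-1) (2 * j))"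
    by (rule gauss_finite_product_dvd) (simp add: cayley_fps_minus flip: power_mult)
  then have "fps_X ^ (2 * Suc n) dvd theta_trunc n - (\<Prod>j=1..n. cayley_fps (-1) (2 * j))"
    by (simp only: theta_trunc_def power_mult)
  then show ?thesis
    by (rule fps_nth_eq_if_X_power_dvd) (use assms in simp)
qed

text \<open>Gauss's identity at x = -X: the signs (-1)^j and (-1)^(j^2) cancel, which gives
  \<phi>(q).\<close>

lemma prod_twisted_factor_nth:
  assumes "i \<le> n"
  shows "(\<Prod>j=1..n. twisted_factor j) $ i = (1 + 2 * (\<Sum>j=1..n. fps_X ^ j\<^sup>2)) $ i"
proof -
  have *: "(-1) ^ j * (- fps_X) ^ j\<^sup>2 = (fps_X ^ j\<^sup>2 :: int fps)" for j
    by (simp add: power_minus[of fps_X] minus_one_power_iff)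
  have "(- fps_X) ^ Suc n dvd 1 + 2 * (\<Sum>j=1..n. (-1) ^ j * (- fps_X) ^ j\<^sup>2) - (\<Prod>j=1..n. twisted_factor j)"
    by (rule gauss_finite_product_dvd) (simp add: twisted_factor_eq)
  then have "fps_X ^ Suc n dvd 1 + 2 * (\<Sum>j=1..n. fps_X ^ j\<^sup>2) - (\<Prod>j=1..n. twisted_factor j)"
    unfolding * by (metis minus_dvd_iff mult_minus1 power_minus minus_one_power_iff mult_1)
  then show ?thesis
    using assms by (metis fps_nth_eq_if_X_power_dvd less_Suc_eq_le)
qed

text \<open>Two of the \<open>t + 2\<close> theta factors clear the denominator of the generating
  function. The bound on parts is \<open>2 * n\<close> because the \<open>n\<close> factors of index
  \<open>2 * j\<close> come from products up to \<open>2 * n\<close>.\<close>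

lemma weight_fps_theta_power:
  "(weight_fps (2 * n) * theta_trunc n ^ (t + 2)) $ n =
    2 * (\<Sum>j=1..2*n. if j\<^sup>2 \<le> n then int (j\<^sup>2) * (theta_trunc n ^ t) $ (n - j\<^sup>2) else 0)"
proof -
  define R where "R = (\<Prod>j=1..n. cayley_fps (-1) (2 * j))"
  define Q where "Q = (\<Prod>j=1..2*n. twisted_factor j)"
  \<comment> \<open>This is X d/dX applied to the truncated \<phi>(q), which brings down the factor
    j^2.\<close>
  define K where "K = 2 * (\<Sum>j=1..2*n. fps_const (int (j\<^sup>2)) * fps_X ^ j\<^sup>2)"
  have R: "theta_trunc n $ i = R $ i" if "i \<le> n" for i
    using that by (simp add: R_def theta_trunc_nth_eq)
  have K: "(fps_X * fps_deriv Q) $ i = K $ i" if "i \<le> n" for i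
  proof -
    have "(fps_X * fps_deriv Q) $ i = int i * Q $ i"
      by (cases i) auto
    also have "Q $ i = (1 + 2 * (\<Sum>j=1..2*n. fps_X ^ j\<^sup>2)) $ i"
      unfolding Q_def using that by (intro prod_twisted_factor_nth) auto
    also have "int i * (1 + 2 * (\<Sum>j=1..2*n. fps_X ^ j\<^sup>2)) $ i = K $ i"
      by (auto simp: K_def fps_sum_nth numeral_fps_const fps_mult_left_const_nth sum_distrib_left
          distrib_left intro!: sum.cong)
    finally show ?thesis .
  qed
  have "weight_fps (2 * n) * R\<^sup>2 = fps_X * fps_deriv Q"
    using weight_fps_mult[of "2 * n"] unfolding R_def Q_def prod_twisted_factor_mult[symmetric]
    by (simp add: mult.assoc)
  then have "weight_fps (2 * n) * R ^ (t + 2) = (fps_X * fps_deriv Q) * R ^ t"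
    by (simp only: power_add mult.assoc mult.commute[of "R ^ t"] flip: \<open>weight_fps (2 * n) * R\<^sup>2 = _\<close>)
  moreover have "(weight_fps (2 * n) * theta_trunc n ^ (t + 2)) $ n = (weight_fps (2 * n) * R ^ (t + 2)) $ n"
    by (intro fps_mult_nth_cong_le[where n = n] fps_power_nth_cong_le[where n = n] R) auto
  moreover have "((fps_X * fps_deriv Q) * R ^ t) $ n = (K * theta_trunc n ^ t) $ n"
    by (intro fps_mult_nth_cong_le[where n = n] fps_power_nth_cong_le[where n = n] R[symmetric] K) auto
  ultimately have "(weight_fps (2 * n) * theta_trunc n ^ (t + 2)) $ n = (K * theta_trunc n ^ t) $ n"
    by (simp only:)
  also have "K * theta_trunc n ^ t =
      2 * (\<Sum>j=1..2*n. fps_const (int (j\<^sup>2)) * (fps_X ^ j\<^sup>2 * theta_trunc n ^ t))"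
    by (simp add: K_def sum_distrib_right mult.assoc)
  also have "\<dots> $ n = 2 * (\<Sum>j=1..2*n. if j\<^sup>2 \<le> n then int (j\<^sup>2) * (theta_trunc n ^ t) $ (n - j\<^sup>2) else 0)"
    by (auto simp: fps_sum_nth numeral_fps_const fps_mult_left_const_nth fps_X_power_mult_nth intro!: sum.cong)
  finally show ?thesis .
qed

text \<open>A pair is determined by k through m = (n - k^2) / 2. Indices with n - j^2 odd contribute
  0, as only even exponents occur in the theta powers.\<close>

lemma sum_theta_trunc_power:
  "(\<Sum>j=1..2*n. if j\<^sup>2 \<le> n then int (j\<^sup>2) * (theta_trunc n ^ t) $ (n - j\<^sup>2) else 0) =
    (\<Sum>(k, m)\<in>{(k, m). 1 \<le> k \<and> k\<^sup>2 + 2 * m = n}. (- 1) ^ m * (int k)\<^sup>2 * int (r_squares t m))"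
proof -
  have "(\<Sum>(k, m)\<in>{(k, m). 1 \<le> k \<and> k\<^sup>2 + 2 * m = n}. (- 1) ^ m * (int k)\<^sup>2 * int (r_squares t m)) =
    (\<Sum>j\<in>{j \<in> {1..2*n}. j\<^sup>2 \<le> n \<and> even (n - j\<^sup>2)}. int (j\<^sup>2) * (theta_trunc n ^ t) $ (n - j\<^sup>2))"
  proof (rule sum.reindex_bij_witness[where i = "\<lambda>j. (j, (n - j\<^sup>2) div 2)" and j = fst])
    fix p assume p: "p \<in> {(k, m). 1 \<le> k \<and> k\<^sup>2 + 2 * m = n}"
    obtain k m where [simp]: "p = (k, m)" by (cases p)
    have k: "1 \<le> k" "n = k\<^sup>2 + 2 * m" using p by auto
    have "k \<le> k\<^sup>2" by (simp add: power2_eq_square)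
    then show "fst p \<in> {j \<in> {1..2*n}. j\<^sup>2 \<le> n \<and> even (n - j\<^sup>2)}"
      using k by simp
    show "(fst p, (n - (fst p)\<^sup>2) div 2) = p" using k by simp
    show "int ((fst p)\<^sup>2) * (theta_trunc n ^ t) $ (n - (fst p)\<^sup>2) =
        (case p of (k, m) \<Rightarrow> (- 1) ^ m * (int k)\<^sup>2 * int (r_squares t m))"
      using theta_trunc_power_nth[of "n - k\<^sup>2" n t] k by simp
  qed auto
  also have "\<dots> = (\<Sum>j=1..2*n. if j\<^sup>2 \<le> n \<and> even (n - j\<^sup>2) then int (j\<^sup>2) * (theta_trunc n ^ t) $ (n - j\<^sup>2) else 0)"
    by (rule sum.inter_filter) simp
  also have "\<dots> = (\<Sum>j=1..2*n. if j\<^sup>2 \<le> n then int (j\<^sup>2) * (theta_trunc n ^ t) $ (n - j\<^sup>2) else 0)"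
    by (intro sum.cong refl) (auto simp: theta_trunc_power_nth)
  finally show ?thesis by simp
qed

theorem theorem3p4:
  fixes \<alpha> n :: nat
  assumes "n \<ge> 1"
  shows "[overline_SOME n = 0] (mod 2 ^ (\<alpha> + 2)) \<longleftrightarrow>
    [(\<Sum>(k, m)\<in>{(k, m). 1 \<le> k \<and> k\<^sup>2 + 2 * m = n}.
        (- 1) ^ m * (int k)\<^sup>2 * int (r_squares (2 ^ (\<alpha> + 1) - 2) m)) = 0] (mod 2 ^ (\<alpha> + 1))"
proof -
  define t :: nat where "t = 2 ^ (\<alpha> + 1) - 2"
  define A where "A = (\<Sum>(k, m)\<in>{(k, m). 1 \<le> k \<and> k\<^sup>2 + 2 * m = n}.
        (- 1) ^ m * (int k)\<^sup>2 * int (r_squares t m))"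
  define D where "D = weight_fps (2 * n)"
  \<comment> \<open>Needed because subtraction on naturals truncates.\<close>
  have "(2::nat) ^ (\<alpha> + 1) \<ge> 2" by simp
  then have t: "t + 2 = 2 ^ (\<alpha> + 1)" unfolding t_def by (rule le_add_diff_inverse2)
  obtain v where v: "theta_trunc n ^ (2 ^ (\<alpha> + 1)) = 1 + 2 ^ Suc (\<alpha> + 1) * v"
    unfolding theta_trunc_def using one_plus_two_power_two_power by blast
  have "2 * A = (D * theta_trunc n ^ (t + 2)) $ n"
    unfolding A_def D_def weight_fps_theta_power sum_theta_trunc_power ..
  also have "\<dots> = (D + fps_const (2 ^ (\<alpha> + 2)) * (D * v)) $ n"
    unfolding t v by (simp add: algebra_simps numeral_fps_const fps_const_power)
  also have "\<dots> = overline_SOME n + 2 ^ (\<alpha> + 2) * (D * v) $ n"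
    using overline_SOME_eq[of n "2 * n"] by (simp add: D_def weight_fps_def fps_mult_left_const_nth)
  finally have "overline_SOME n = 2 * A - 2 ^ (\<alpha> + 2) * (D * v) $ n" by simp
  \<comment> \<open>The factor 2 in front of \<open>A\<close> accounts for the two different
    moduli.\<close>
  then have "2 ^ (\<alpha> + 2) dvd overline_SOME n \<longleftrightarrow> 2 * 2 ^ (\<alpha> + 1) dvd 2 * A"
    by (metis add_2_eq_Suc' Suc_eq_plus1 dvd_diff_left_iff dvd_triv_left power_Suc)
  then have "2 ^ (\<alpha> + 2) dvd overline_SOME n \<longleftrightarrow> 2 ^ (\<alpha> + 1) dvd A"
    unfolding dvd_mult_cancel_left by simp
  then show ?thesis
    unfolding cong_0_iff A_def t_def .
qed

end
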